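(* Let $\mathfrak{S}$ be a board with no isolated point and let $g\in\mathscr{F}(\mathfrak{S},\mathbb{Z})$. Then $g\in V(\mathfrak{S},\mathbb{Z})$ if and only if $\tilde g\in V(\mathfrak{S},\mathbb{F}_2)$.
   Context: A board $\mathfrak{S}$ is a finite subset of $\mathbb{Z}^2$. $\mathscr{F}(\mathfrak{S},R)$ denotes functions $\mathfrak{S}\to R$; $[P]$ is the function equal to $1$ at $P$ and $0$ elsewhere. The set of moves $\mathscr{D}(\mathfrak{S})$ consists of all functions $[P]+[Q]-[R]$ with $P,Q,R\in\mathfrak{S}$, $Q=P+v$, $R=P+2v$ for some $v\in\{(\pm1,0),(0,\pm1)\}$; $Q$ is the middle point and $P,R$ the extremities. $V(\mathfrak{S},\mathbb{Z})$ is the $\mathbb{Z}$-span of $\mathscr{D}(\mathfrak{S})$ in $\mathscr{F}(\mathfrak{S},\mathbb{Z})$. For $g\in\mathscr{F}(\mathfrak{S},\mathbb{Z})$, $\tilde g\in\mathscr{F}(\mathfrak{S},\mathbb{F}_2)$ is its reduction modulo $2$, and $V(\mathfrak{S},\mathbb{F}_2)$ is the $\mathbb{F}_2$-span of $\{\tilde{\mathfrak{g}}:\mathfrak{g}\in\mathscr{D}(\mathfrak{S})\}$. Two points are neighbors if they are the two extremities of some move; $\equiv$ is the reflexive-transitive closure of this relation. The board has no isolated point if every $P\in\mathfrak{S}$ is $\equiv$-equivalent to the middle point of some move. *)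

theory Defs
  imports HOL.Modules "HOL-Library.Z2" "HOL-Library.Function_Algebras" "HOL-Library.Product_Plus"
begin

type_synonym point = "int \<times> int"

text \<open>A function on the board \<open>S\<close> with values in a ring is encoded as a function on the whole
  lattice that vanishes off \<open>S\<close>. The field with two elements is the type \<^typ>\<open>bit\<close>.\<close>

definition board_funs :: "point set \<Rightarrow> (point \<Rightarrow> 'r::zero) set" where
  "board_funs S = {f. \<forall>X. X \<notin> S \<longrightarrow> f X = 0}"

definition pt :: "point \<Rightarrow> point \<Rightarrow> 'r::zero_neq_one" where
  "pt P = (\<lambda>X. if X = P then 1 else 0)"

definition directions :: "point set" where
  "directions = {(1, 0), (-1, 0), (0, 1), (0, -1)}"

text \<open>\<open>P\<close> and \<open>R\<close> are the extremities of the move, \<open>Q\<close> is its middle point.\<close>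

definition is_move :: "point set \<Rightarrow> point \<Rightarrow> point \<Rightarrow> point \<Rightarrow> bool" where
  "is_move S P Q R \<longleftrightarrow> P \<in> S \<and> Q \<in> S \<and> R \<in> S \<and>
     (\<exists>v \<in> directions. Q = P + v \<and> R = P + (v + v))"

definition moves :: "point set \<Rightarrow> (point \<Rightarrow> int) set" where
  "moves S = {pt P + pt Q - pt R | P Q R. is_move S P Q R}"

definition fun_scale :: "'r::comm_ring_1 \<Rightarrow> (point \<Rightarrow> 'r) \<Rightarrow> (point \<Rightarrow> 'r)" where
  "fun_scale c f = (\<lambda>X. c * f X)"

lemma module_fun_scale: "module (fun_scale :: 'r::comm_ring_1 \<Rightarrow> _)"
  by unfold_locales (auto simp: fun_scale_def fun_eq_iff algebra_simps)

definition reduce2 :: "(point \<Rightarrow> int) \<Rightarrow> (point \<Rightarrow> bit)" where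
  "reduce2 g = (\<lambda>X. of_int (g X))"

definition V_int :: "point set \<Rightarrow> (point \<Rightarrow> int) set" where
  "V_int S = module.span fun_scale (moves S)"

definition V_F2 :: "point set \<Rightarrow> (point \<Rightarrow> bit) set" where
  "V_F2 S = module.span fun_scale (reduce2 ` moves S)"

definition neighbors :: "point set \<Rightarrow> point \<Rightarrow> point \<Rightarrow> bool" where
  "neighbors S P R \<longleftrightarrow> (\<exists>Q. is_move S P Q R)"

definition board_equiv :: "point set \<Rightarrow> point \<Rightarrow> point \<Rightarrow> bool" where
  "board_equiv S = (neighbors S)\<^sup>*\<^sup>*"

definition no_isolated_point :: "point set \<Rightarrow> bool" where
  "no_isolated_point S \<longleftrightarrow>
     (\<forall>P \<in> S. \<exists>A Q B. is_move S A Q B \<and> board_equiv S P Q)"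

end

theory Submission
  imports Defs
begin

text \<open>A move and its reverse, \<open>[P] + [Q] - [R]\<close> and \<open>[R] + [Q] - [P]\<close>, have sum \<open>2[Q]\<close> and
  difference \<open>2[P] - 2[R]\<close>. Hence \<open>2[X]\<close> lies in the integral span for every middle point \<open>X\<close>,
  this property passes to neighbors, and on a board with no isolated point the span contains every
  function with even values. Lifting an \<open>\<bbbF>\<^sub>2\<close>-combination of reduced moves to an integral one
  changes the function only by such an even function.\<close>

interpretation fun_int: module "fun_scale :: int \<Rightarrow> _"
  by (rule module_fun_scale)

interpretation fun_bit: module "fun_scale :: bit \<Rightarrow> _"
  by (rule module_fun_scale)

text \<open>As 2 = 0 in \<open>bit\<close>, an integer 2m maps to 0 and 2m + 1 maps to 1.\<close>

lemma of_int_bit_eq_0_iff: "(of_int k :: bit) = 0 \<longleftrightarrow> even k"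
proof (cases "even k")
  case True
  then obtain m where "k = 2 * m" by blast
  then show ?thesis by simp
next
  case False
  then obtain m where "k = 2 * m + 1" by (rule oddE)
  then show ?thesis by simp
qed

lemma reduce2_add: "reduce2 (f + g) = reduce2 f + reduce2 g"
  by (simp add: reduce2_def fun_eq_iff)

lemma reduce2_scale: "reduce2 (fun_scale c f) = fun_scale (of_int c) (reduce2 f)"
  by (simp add: reduce2_def fun_scale_def)

lemma reduce2_zero: "reduce2 0 = 0"
  by (simp add: reduce2_def fun_eq_iff)

lemma V_int_moveI: "is_move S P Q R \<Longrightarrow> pt P + pt Q - pt R \<in> V_int S"
  unfolding V_int_def unfolding moves_def by (intro fun_int.span_base) blast

text \<open>The set \<open>directions\<close> is closed under negation, so a move along
  \<open>v\<close> can be read from \<open>R\<close> along \<open>- v\<close> with the same middle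
  point.\<close>

lemma is_move_reverse:
  assumes "is_move S P Q R"
  shows "is_move S R Q P"
proof -
  from assms obtain v where v: "v \<in> directions" "Q = P + v" "R = P + (v + v)"
    and PQR: "P \<in> S" "Q \<in> S" "R \<in> S"
    by (auto simp: is_move_def)
  have "- v \<in> directions"
    using v(1) by (auto simp: directions_def)
  moreover have "Q = R + - v" "P = R + (- v + - v)"
    by (simp_all add: v prod_eq_iff)
  ultimately show ?thesis
    using PQR unfolding is_move_def by blast
qed

lemma double_middle_in_V_int:
  assumes "is_move S P Q R"
  shows "fun_scale 2 (pt Q) \<in> V_int S"
proof -
  have "(pt P + pt Q - pt R) + (pt R + pt Q - pt P) \<in> V_int S"
    using V_int_moveI[OF assms] V_int_moveI[OF is_move_reverse[OF assms]]
    unfolding V_int_def by (rule fun_int.span_add)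
  also have "(pt P + pt Q - pt R) + (pt R + pt Q - pt P) = fun_scale 2 (pt Q)"
    by (simp add: fun_scale_def fun_eq_iff)
  finally show ?thesis .
qed

lemma double_neighbor_in_V_int:
  assumes "neighbors S P R" and "fun_scale 2 (pt R) \<in> V_int S"
  shows "fun_scale 2 (pt P) \<in> V_int S"
proof -
  from assms(1) obtain Q where Q: "is_move S P Q R"
    by (auto simp: neighbors_def)
  have "(pt P + pt Q - pt R) - (pt R + pt Q - pt P) + fun_scale 2 (pt R) \<in> V_int S"
    using V_int_moveI[OF Q] V_int_moveI[OF is_move_reverse[OF Q]] assms(2)
    unfolding V_int_def by (metis fun_int.span_add fun_int.span_diff)
  also have "(pt P + pt Q - pt R) - (pt R + pt Q - pt P) + fun_scale 2 (pt R) = fun_scale 2 (pt P)"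
    by (simp add: fun_scale_def fun_eq_iff)
  finally show ?thesis .
qed

lemma double_point_in_V_int:
  assumes "no_isolated_point S" and "P \<in> S"
  shows "fun_scale 2 (pt P) \<in> V_int S"
proof -
  from assms obtain A Q B where "is_move S A Q B" and equiv: "(neighbors S)\<^sup>*\<^sup>* P Q"
    by (auto simp: no_isolated_point_def board_equiv_def)
  then have "fun_scale 2 (pt Q) \<in> V_int S"
    by (intro double_middle_in_V_int)
  \<comment> \<open>The induction starts at the middle point \<open>Q\<close> and walks the chain of
    neighbors backwards to \<open>P\<close>; each link passes the property from its second point to
    its first.\<close>
  with equiv show ?thesis
    by (induction rule: converse_rtranclp_induct) (auto intro: double_neighbor_in_V_int)
qed

lemma even_fun_in_V_int:
  assumes "finite S" and "no_isolated_point S" and "f \<in> board_funs S" and even: "\<And>X. even (f X)"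
  shows "f \<in> V_int S"
proof -
  \<comment> \<open>The halving is exact since all values of \<open>f\<close> are even, and points
    of \<open>S\<close> suffice since \<open>f\<close> vanishes elsewhere.\<close>
  have "f = (\<Sum>P\<in>S. fun_scale (f P div 2) (fun_scale 2 (pt P)))"
  proof
    fix X
    have "(\<Sum>P\<in>S. fun_scale (f P div 2) (fun_scale 2 (pt P))) X
        = (\<Sum>P\<in>S. fun_scale (f P div 2) (fun_scale 2 (pt P)) X)"
      by (induction S rule: infinite_finite_induct) simp_all
    also have "\<dots> = (\<Sum>P\<in>S. if P = X then f P else 0)"
      using even by (intro sum.cong) (auto simp: fun_scale_def pt_def)
    also have "\<dots> = f X"
      using assms(1,3) by (cases X) (simp add: board_funs_def)
    finally show "f X = (\<Sum>P\<in>S. fun_scale (f P div 2) (fun_scale 2 (pt P))) X" ..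
  qed
  also have "\<dots> \<in> V_int S"
    using double_point_in_V_int[OF assms(2)] unfolding V_int_def
    by (intro fun_int.span_sum fun_int.span_scale[of "fun_scale 2 _"])
  finally show ?thesis .
qed

text \<open>Guarantees that the difference of a board function and an element of the span still
  vanishes off \<open>S\<close>, as \<open>even_fun_in_V_int\<close> demands.\<close>

lemma V_int_subset_board_funs: "V_int S \<subseteq> board_funs S"
  unfolding V_int_def
proof (rule fun_int.span_minimal)
  show "moves S \<subseteq> board_funs S"
    by (auto simp: moves_def is_move_def board_funs_def pt_def)
  show "fun_int.subspace (board_funs S)"
    by (auto simp: fun_int.subspace_def board_funs_def fun_scale_def)
qed

text \<open>Reduction respects sums and scalars, so it sends integral combinations of moves to
  combinations of reduced moves. Conversely, the image is closed under scaling by \<open>bit\<close>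
  because every such scalar is the reduction of an integer.\<close>

lemma V_F2_eq_image_V_int: "V_F2 S = reduce2 ` V_int S"
proof
  show "V_F2 S \<subseteq> reduce2 ` V_int S"
    unfolding V_F2_def
  proof (rule fun_bit.span_minimal)
    show "reduce2 ` moves S \<subseteq> reduce2 ` V_int S"
      unfolding V_int_def by (intro image_mono fun_int.span_superset)
    show "fun_bit.subspace (reduce2 ` V_int S)"
      unfolding fun_bit.subspace_def
    proof (intro conjI ballI allI)
      show "0 \<in> reduce2 ` V_int S"
        unfolding V_int_def by (metis reduce2_zero fun_int.span_zero imageI)
    next
      fix x y assume "x \<in> reduce2 ` V_int S" "y \<in> reduce2 ` V_int S"
      then show "x + y \<in> reduce2 ` V_int S"
        unfolding V_int_def
        by (auto simp flip: reduce2_add intro!: imageI fun_int.span_add)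
    next
      fix c :: bit and x assume "x \<in> reduce2 ` V_int S"
      then obtain f where f: "f \<in> V_int S" "x = reduce2 f" by blast
      \<comment> \<open>An integral lift of \<open>c\<close>: its reduction modulo 2 is
        \<open>c\<close> again.\<close>
      define k :: int where "k = (if c = 0 then 0 else 1)"
      have "fun_scale c x = reduce2 (fun_scale k f)"
        by (cases c) (simp_all add: f reduce2_scale reduce2_zero k_def)
      moreover have "fun_scale k f \<in> V_int S"
        using f(1) unfolding V_int_def by (rule fun_int.span_scale)
      ultimately show "fun_scale c x \<in> reduce2 ` V_int S" by blast
    qed
  qed
next
  have "reduce2 f \<in> V_F2 S" if "f \<in> fun_int.span (moves S)" for f
    using that
  \<comment> \<open>A combination is built by adding one scaled move at a time, and each such step
    is mirrored in the span over \<open>bit\<close>.\<close>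
  proof (induction rule: fun_int.span_induct_alt)
    case base
    have "reduce2 0 \<in> V_F2 S"
      unfolding reduce2_zero V_F2_def by (rule fun_bit.span_zero)
    then show ?case by (simp add: zero_fun_def)
  next
    case (step c x y)
    then show ?case
      unfolding V_F2_def reduce2_add reduce2_scale
      by (intro fun_bit.span_add fun_bit.span_scale) (auto intro: fun_bit.span_base)
  qed
  then show "reduce2 ` V_int S \<subseteq> V_F2 S"
    by (auto simp: V_int_def)
qed

theorem theorem2:
  fixes S :: "point set" and g :: "point \<Rightarrow> int"
  assumes "finite S"
    and "no_isolated_point S"
    and "g \<in> board_funs S"
  shows "g \<in> V_int S \<longleftrightarrow> reduce2 g \<in> V_F2 S"
proof
  assume "g \<in> V_int S"
  then show "reduce2 g \<in> V_F2 S"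
    by (simp add: V_F2_eq_image_V_int)
next
  assume "reduce2 g \<in> V_F2 S"
  then obtain h where h: "h \<in> V_int S" "reduce2 g = reduce2 h"
    by (auto simp: V_F2_eq_image_V_int)
  \<comment> \<open>\<open>h\<close> is a lift of \<open>reduce2 g\<close> inside the integral span;
    it remains to see that the error \<open>g - h\<close> is even and supported on
    \<open>S\<close>.\<close>
  have "(of_int (g X - h X) :: bit) = 0" for X
    using fun_cong[OF h(2), of X] by (simp add: reduce2_def)
  then have "even ((g - h) X)" for X
    by (simp only: of_int_bit_eq_0_iff fun_diff_def)
  moreover have "g - h \<in> board_funs S"
    using assms(3) h(1) V_int_subset_board_funs[of S] by (auto simp: board_funs_def)
  ultimately have "g - h \<in> V_int S"
    using assms(1,2) by (intro even_fun_in_V_int)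
  then have "(g - h) + h \<in> V_int S"
    using h(1) unfolding V_int_def by (rule fun_int.span_add)
  then show "g \<in> V_int S" by simp
qed

end
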